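(* Let $\boldsymbol{f}^n \in \mathbb{R}_+^N$ with $\|\boldsymbol{f}^n\|_1 = V$, let $\boldsymbol{f}(t_{n+1})$ be the exact solution at time $t_{n+1}$ of the ODE system started from $\boldsymbol{f}^n$ at time $t_n$ (see context), and let $\boldsymbol{f}^{n+1}$ be a numerical approximation produced by a positive and conservative scheme, i.e. $\boldsymbol{f}^{n+1} \in \mathbb{R}_+^N$ and $\|\boldsymbol{f}^{n+1}\|_1 = \|\boldsymbol{f}(t_{n+1})\|_1 = V$. Suppose that $\eta(\boldsymbol{f}^{n+1}) > \eta(\boldsymbol{f}^n)$ and that $\beta \in (0,1]$ satisfies $$\eta\big(\boldsymbol{f}^{n+1} + \beta(\boldsymbol{1} - \boldsymbol{f}^{n+1})\big) = \eta(\boldsymbol{f}(t_{n+1})).$$ If $\|\boldsymbol{f}(t_{n+1}) - \boldsymbol{f}^{n+1}\|_2 \le 1$, then $$\|\beta(\boldsymbol{1} - \boldsymbol{f}^{n+1})\|_2 \le M\, \|\boldsymbol{f}(t_{n+1}) - \boldsymbol{f}^{n+1}\|_2 \Big(1 + \big|\log\big(\|\boldsymbol{f}(t_{n+1}) - \boldsymbol{f}^{n+1}\|_2\big)\big|\Big),$$ where $M > 0$ is a constant which depends only on $V$, $\|\boldsymbol{f}^{n+1}\|_\infty$ and $\|\boldsymbol{f}(t_{n+1})\|_\infty$.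
   Context: $N \ge 1$ is an integer, $\Delta v_1,\dots,\Delta v_N > 0$ are fixed weights, $V = \sum_{i=1}^N \Delta v_i$, $\boldsymbol{1} = (1,\dots,1)^T$, and $\mathbb{R}_+ = [0,\infty)$. Norms are weighted: $\|\boldsymbol{f}\|_p = \big(\sum_{i=1}^N |f_i|^p \Delta v_i\big)^{1/p}$ for $p=1,2$, and $\|\boldsymbol{f}\|_\infty = \max_i |f_i|$. The Gibbs entropy is $\eta(\boldsymbol{f}) = \sum_{i=1}^N f_i \log f_i\, \Delta v_i$, with $0\log 0 = 0$. The ODE system is $\frac{\mathrm{d} f_i}{\mathrm{d}t} = Q_i(\boldsymbol{f}(t))$, $i=1,\dots,N$. It is assumed that its solutions (with nonnegative initial data) have the properties: conservation of mass, $\frac{\mathrm{d}}{\mathrm{d}t}\sum_i f_i(t)\Delta v_i = 0$; nonnegativity, $f_i(t) \ge 0$; monotonicity of entropy, $\frac{\mathrm{d}}{\mathrm{d}t}\sum_i f_i(t)\log f_i(t)\Delta v_i \le 0$, i.e. $\eta(\boldsymbol{f}(t))$ is nonincreasing in $t$. Here $t_n < t_{n+1}$ and $\boldsymbol{f}(t)$ denotes the solution with $\boldsymbol{f}(t_n) = \boldsymbol{f}^n$; in particular $\eta(\boldsymbol{f}(t_{n+1})) \le \eta(\boldsymbol{f}^n)$. All vectors are normalized so that the weighted average of their components is $1$, i.e. $\|\cdot\|_1 = V$. *)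

theory Defs
  imports Complex_Main "Jordan_Normal_Form.Matrix"
begin

text \<open>
  The dimension \<open>N\<close> is a term, so that a constant can be chosen before \<open>N\<close>; vectors of
  \<open>\<real>\<^sup>N\<close> are elements of \<^term>\<open>carrier_vec N\<close>, with components indexed by \<open>0, \<dots>, N - 1\<close>.
  The vector \<open>w\<close> collects the weights \<open>\<Delta>v\<^sub>i\<close>.
\<close>

definition nonneg_vecs :: "nat \<Rightarrow> real vec set" where
  "nonneg_vecs N = {f \<in> carrier_vec N. \<forall>i<N. 0 \<le> f $ i}"

definition ones :: "nat \<Rightarrow> real vec" where
  "ones N = vec N (\<lambda>_. 1)"

definition volume :: "real vec \<Rightarrow> real" where
  "volume w = (\<Sum>i<dim_vec w. w $ i)"

definition wnorm :: "real vec \<Rightarrow> real \<Rightarrow> real vec \<Rightarrow> real" where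
  "wnorm w p f = (\<Sum>i<dim_vec f. \<bar>f $ i\<bar> powr p * w $ i) powr (1 / p)"

definition maxnorm :: "real vec \<Rightarrow> real" where
  "maxnorm f = Max ((\<lambda>i. \<bar>f $ i\<bar>) ` {..<dim_vec f})"

text \<open>The convention \<open>0 log 0 = 0\<close> is automatic, the first factor being zero.\<close>

definition entropy :: "real vec \<Rightarrow> real vec \<Rightarrow> real" where
  "entropy w f = (\<Sum>i<dim_vec f. f $ i * ln (f $ i) * w $ i)"

text \<open>Derivatives at the end points of the time interval are one-sided.\<close>

definition ode_solution ::
    "nat \<Rightarrow> (nat \<Rightarrow> real vec \<Rightarrow> real) \<Rightarrow> real \<Rightarrow> real \<Rightarrow> (real \<Rightarrow> real vec) \<Rightarrow> bool" where
  "ode_solution N Q a b f \<longleftrightarrow>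
     (\<forall>t\<in>{a..b}. f t \<in> carrier_vec N \<and>
       (\<forall>i<N. ((\<lambda>s. f s $ i) has_real_derivative Q i (f t)) (at t within {a..b})))"

text \<open>
  The standing assumption on the system: every solution with nonnegative initial data conserves
  mass, stays nonnegative and has nonincreasing entropy. Entropy decay is stated as monotonicity
  because the entropy need not be differentiable in time where a component vanishes.
\<close>

definition structure_preserving ::
    "nat \<Rightarrow> real vec \<Rightarrow> (nat \<Rightarrow> real vec \<Rightarrow> real) \<Rightarrow> bool" where
  "structure_preserving N w Q \<longleftrightarrow>
     (\<forall>a b f. a < b \<longrightarrow> ode_solution N Q a b f \<longrightarrow> f a \<in> nonneg_vecs N \<longrightarrow>
       (\<forall>t\<in>{a..b}. ((\<lambda>s. \<Sum>i<N. f s $ i * w $ i) has_real_derivative 0) (at t within {a..b})) \<and>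
       (\<forall>t\<in>{a..b}. f t \<in> nonneg_vecs N) \<and>
       antimono_on {a..b} (\<lambda>t. entropy w (f t)))"

end

theory Submission
  imports Defs "HOL-Analysis.L2_Norm"
begin

text \<open>
  Write \<open>h = f(t\<^sub>1)\<close>, \<open>\<epsilon> = \<parallel>h - g\<parallel>\<^sub>2\<close> and \<open>\<Phi>(x) = x log x - x + 1\<close>. Convexity of \<open>x log x\<close> along the
  segment from \<open>g\<close> to \<open>\<one>\<close> gives \<open>\<beta> \<eta>(g) \<le> \<eta>(g) - \<eta>(h)\<close>. As all masses equal \<open>V\<close>, the entropies
  of \<open>g\<close> and \<open>h\<close> are the weighted sums of \<open>\<Phi>\<close>. From below,
  \<open>\<Phi>(x) \<ge> (x - 1)\<^sup>2 / (2 (x + 1))\<close>; from above,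
  \<open>\<Phi>(a) - \<Phi>(b) \<le> 2 \<bar>a - 1\<bar> (\<bar>a - b\<bar> + \<epsilon>) (1 + \<bar>log \<epsilon>\<bar>)\<close>, so by Cauchy--Schwarz both sides carry a
  factor \<open>\<parallel>g - \<one>\<parallel>\<^sub>2\<close>, which cancels once and leaves \<open>M = 4 (\<parallel>g\<parallel>\<^sub>\<infinity> + 1) (1 + \<surd>V)\<close>.
\<close>

section \<open>Scalar inequalities for \<open>x * ln x\<close>\<close>

text \<open>The derivative of \<open>x * ln x - x\<close> is \<open>ln x\<close>, so this is
  convexity in tangent form; tangency at \<open>u > 0\<close> still allows
  \<open>x = 0\<close>.\<close>

lemma xlnx_tangent_le:
  fixes x u :: real
  assumes "0 \<le> x" "0 < u"
  shows "(u * ln u - u) - (x * ln x - x) \<le> ln u * (u - x)"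
proof (cases "x = 0")
  case True
  then show ?thesis using assms by (simp add: algebra_simps)
next
  case False
  then have x: "x > 0" using assms by simp
  have "x * (ln u - ln x) \<le> x * (u / x - 1)"
    using x assms ln_le_minus_one[of "u / x"] by (intro mult_left_mono) (auto simp: ln_div)
  also have "\<dots> = u - x" using x by (simp add: field_simps)
  finally show ?thesis by (simp add: algebra_simps)
qed

lemma xlnx_segment_to_one_le:
  fixes x \<beta> :: real
  assumes "0 \<le> x" "0 < \<beta>" "\<beta> \<le> 1"
  shows "(x + \<beta> * (1 - x)) * ln (x + \<beta> * (1 - x)) \<le> (1 - \<beta>) * (x * ln x)"
proof -
  define u where "u = x + \<beta> * (1 - x)"
  have "u = (1 - \<beta>) * x + \<beta>" by (simp add: u_def algebra_simps)
  then have u: "u > 0" using assms by (simp add: add_nonneg_pos)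
  \<comment> \<open>Tangents at the mean \<open>u\<close>, compared at \<open>x\<close> and at
    \<open>1\<close>; with weights \<open>1 - \<beta>\<close> and \<open>\<beta>\<close> the slope
    terms cancel.\<close>
  have "(1 - \<beta>) * ((u * ln u - u) - (x * ln x - x)) \<le> (1 - \<beta>) * (ln u * (u - x))"
    using xlnx_tangent_le[OF assms(1) u] assms by (intro mult_left_mono) auto
  moreover have "\<beta> * ((u * ln u - u) - (1 * ln 1 - 1)) \<le> \<beta> * (ln u * (u - 1))"
    using xlnx_tangent_le[OF zero_le_one u] assms by (intro mult_left_mono) auto
  ultimately have "(1 - \<beta>) * ((u * ln u - u) - (x * ln x - x)) + \<beta> * ((u * ln u - u) + 1)
      \<le> ln u * (u - ((1 - \<beta>) * x + \<beta>))"
    by (simp add: algebra_simps)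
  also have "\<dots> = 0" using \<open>u = (1 - \<beta>) * x + \<beta>\<close> by simp
  finally have "u * ln u - u - (1 - \<beta>) * (x * ln x) + ((1 - \<beta>) * x + \<beta>) \<le> 0"
    by (simp add: algebra_simps)
  then have "u * ln u \<le> (1 - \<beta>) * (x * ln x)"
    using \<open>u = (1 - \<beta>) * x + \<beta>\<close> by linarith
  then show ?thesis by (simp add: u_def)
qed

text \<open>With \<open>s = sqrt x\<close>, the left side factors as
  \<open>(s - 1)\<^sup>2 * (s + 1)\<^sup>2\<close>; the logarithm bound at \<open>1 / s\<close>
  controls the first factor, and the second is at most \<open>2 * (x + 1)\<close>.\<close>

lemma xlnx_ge_quadratic:
  fixes x :: real
  assumes "0 \<le> x"
  shows "(x - 1)\<^sup>2 \<le> 2 * (x + 1) * (x * ln x - x + 1)"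
proof (cases "x = 0")
  case True
  then show ?thesis by simp
next
  case False
  define s where "s = sqrt x"
  have s: "s > 0" "x = s\<^sup>2" using assms False by (auto simp: s_def)
  have "- ln s \<le> 1 / s - 1"
    using ln_le_minus_one[of "1 / s"] s by (simp add: ln_div)
  then have "2 * s\<^sup>2 * (- ln s) \<le> 2 * s\<^sup>2 * (1 / s - 1)"
    by (intro mult_left_mono) auto
  also have "\<dots> = 2 * s - 2 * s\<^sup>2" using s by (simp add: field_simps power2_eq_square)
  finally have "(s - 1)\<^sup>2 \<le> x * ln x - x + 1"
    using s by (simp add: ln_mult power2_eq_square algebra_simps)
  moreover have "(s + 1)\<^sup>2 \<le> 2 * (x + 1)"
    using zero_le_power2[of "s - 1"] s by (simp add: power2_eq_square algebra_simps)
  ultimately have "(s + 1)\<^sup>2 * (s - 1)\<^sup>2 \<le> 2 * (x + 1) * (x * ln x - x + 1)"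
    using assms by (intro mult_mono) auto
  moreover have "(s + 1)\<^sup>2 * (s - 1)\<^sup>2 = (x - 1)\<^sup>2"
    using s by (simp add: power2_eq_square algebra_simps)
  ultimately show ?thesis by simp
qed

text \<open>The factor \<open>\<bar>a - 1\<bar>\<close> is what cancels later. For
  \<open>a \<ge> 1/2\<close> it comes from the slope \<open>ln a\<close>; for \<open>a < 1/2\<close>
  it exceeds \<open>1/2\<close>, so a bound without it suffices.\<close>

lemma xlnx_diff_le:
  fixes a b \<epsilon> :: real
  assumes a: "0 \<le> a" and b: "0 \<le> b" and \<epsilon>: "0 < \<epsilon>" "\<epsilon> \<le> 1"
  shows "(a * ln a - a) - (b * ln b - b) \<le> 2 * \<bar>a - 1\<bar> * ((\<bar>a - b\<bar> + \<epsilon>) * (1 + \<bar>ln \<epsilon>\<bar>))"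
proof (cases "a < 1/2")
  case False
  then have a2: "a \<ge> 1/2" by simp
  have "\<bar>ln a\<bar> \<le> 2 * \<bar>a - 1\<bar>"
  proof (cases "a \<ge> 1")
    case True
    then show ?thesis using ln_le_minus_one[of a] by simp
  next
    case False
    have "- ln a \<le> (1 - a) / a"
      using ln_le_minus_one[of "1 / a"] a2 by (simp add: ln_div field_simps)
    also have "\<dots> \<le> 2 * (1 - a)"
      using mult_nonneg_nonneg[of "1 - a" "2 * a - 1"] a2 False by (simp add: field_simps)
    finally show ?thesis using a2 False by simp
  qed
  then have "\<bar>ln a\<bar> * \<bar>a - b\<bar> \<le> 2 * \<bar>a - 1\<bar> * ((\<bar>a - b\<bar> + \<epsilon>) * 1)"
    using \<epsilon> by (intro mult_mono) auto
  also have "\<dots> \<le> 2 * \<bar>a - 1\<bar> * ((\<bar>a - b\<bar> + \<epsilon>) * (1 + \<bar>ln \<epsilon>\<bar>))"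
    using \<epsilon> by (intro mult_left_mono) auto
  finally have "\<bar>ln a * (a - b)\<bar> \<le> \<dots>" by (simp add: abs_mult)
  then show ?thesis using xlnx_tangent_le[OF b, of a] a2 by linarith
next
  case True
  \<comment> \<open>The slope \<open>ln a\<close> is unbounded as \<open>a\<close> tends to 0, so the tangent is taken at \<open>max a \<epsilon>\<close>.\<close>
  define c where "c = max a \<epsilon>"
  define L where "L = \<bar>ln \<epsilon>\<bar>"
  have L: "L = - ln \<epsilon>" "L \<ge> 0" using \<epsilon> by (auto simp: L_def)
  have c: "\<epsilon> \<le> c" "c \<le> 1" "0 < c" "a \<le> c" using True \<epsilon> by (auto simp: c_def)
  \<comment> \<open>Cost of replacing \<open>a\<close> by \<open>c\<close>: zero if
    \<open>a \<ge> \<epsilon>\<close>; otherwise \<open>c = \<epsilon>\<close> and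
    \<open>a * ln a - a \<le> 0\<close>, leaving
    \<open>\<epsilon> - \<epsilon> * ln \<epsilon>\<close>.\<close>
  have "(a * ln a - a) - (c * ln c - c) \<le> \<epsilon> * (1 + L)"
  proof (cases "a \<ge> \<epsilon>")
    case True
    then show ?thesis using L(2) \<epsilon> by (simp add: c_def)
  next
    case False
    have "a * ln a \<le> 0"
      using a True by (cases "a = 0") (auto simp: mult_nonneg_nonpos)
    then show ?thesis using False a L by (simp add: c_def algebra_simps)
  qed
  \<comment> \<open>For \<open>b \<ge> c\<close> the slope has size at most \<open>L\<close> and
    \<open>b - c \<le> b - a\<close>; for \<open>b < c\<close> the left side is nonpositive.\<close>
  moreover have "ln c * (c - b) \<le> \<bar>a - b\<bar> * (1 + L)"
  proof (cases "b \<ge> c")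
    case True
    have "- ln c \<le> L" using c \<epsilon> L by simp
    then have "(- ln c) * (b - c) \<le> (1 + L) * \<bar>a - b\<bar>"
      using True c L by (intro mult_mono) auto
    then show ?thesis by (simp add: algebra_simps)
  next
    case False
    then have "ln c * (c - b) \<le> 0" using c by (intro mult_nonpos_nonneg) auto
    also have "0 \<le> \<bar>a - b\<bar> * (1 + L)" using L by simp
    finally show ?thesis .
  qed
  ultimately have "(a * ln a - a) - (b * ln b - b) \<le> (\<bar>a - b\<bar> + \<epsilon>) * (1 + L)"
    using xlnx_tangent_le[OF b c(3)] unfolding distrib_right by linarith
  also have "\<dots> \<le> 2 * \<bar>a - 1\<bar> * ((\<bar>a - b\<bar> + \<epsilon>) * (1 + L))"
    using mult_right_mono[of 1 "2 * \<bar>a - 1\<bar>" "(\<bar>a - b\<bar> + \<epsilon>) * (1 + L)"] True \<epsilon> L by simp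
  finally show ?thesis by (simp add: L_def)
qed

section \<open>Weighted norms\<close>

text \<open>Moving the roots of the weights into the vector opens the way to Cauchy-Schwarz,
  definiteness and scaling of \<open>L2_set\<close>.\<close>

lemma wnorm_2_eq_L2_set:
  assumes "\<forall>i<dim_vec f. 0 \<le> w $ i"
  shows "wnorm w 2 f = L2_set (\<lambda>i. sqrt (w $ i) * f $ i) {..<dim_vec f}"
proof -
  have "\<bar>f $ i\<bar> powr 2 * w $ i = (sqrt (w $ i) * f $ i)\<^sup>2" if "i < dim_vec f" for i
    using assms that by (simp add: power_mult_distrib)
  then show ?thesis
    unfolding wnorm_def L2_set_def
    by (subst powr_half_sqrt) (auto intro!: sum_nonneg sum.cong arg_cong[where f = sqrt] simp: assms)
qed

lemma wnorm_1_nonneg_vecs: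
  assumes "f \<in> nonneg_vecs N" "\<forall>i<N. 0 \<le> w $ i"
  shows "wnorm w 1 f = (\<Sum>i<N. f $ i * w $ i)"
proof -
  have "dim_vec f = N" "\<forall>i<N. 0 \<le> f $ i" using assms by (auto simp: nonneg_vecs_def)
  \<comment> \<open>\<open>x powr 1 = x\<close> needs \<open>0 \<le> x\<close>; here
    \<open>x\<close> is the whole sum.\<close>
  moreover have "0 \<le> (\<Sum>i<N. f $ i * w $ i)"
    using calculation assms(2) by (intro sum_nonneg) auto
  ultimately show ?thesis by (simp add: wnorm_def)
qed

lemma L2_set_sqrt_weights:
  assumes "w \<in> carrier_vec N" "\<forall>i<N. 0 \<le> w $ i"
  shows "L2_set (\<lambda>i. sqrt (w $ i)) {..<N} = sqrt (volume w)"
  using assms by (auto simp: L2_set_def volume_def intro!: sum.cong arg_cong[where f = sqrt])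

section \<open>Entropy estimates for vectors\<close>

text \<open>Componentwise convexity; the end point \<open>ones N\<close> has entropy zero and so
  contributes no second term.\<close>

lemma entropy_segment_to_ones_le:
  assumes "g \<in> nonneg_vecs N" "\<forall>i<N. 0 \<le> w $ i" "0 < \<beta>" "\<beta> \<le> 1"
  shows "entropy w (g + \<beta> \<cdot>\<^sub>v (ones N - g)) \<le> (1 - \<beta>) * entropy w g"
proof -
  have g: "dim_vec g = N" "\<forall>i<N. 0 \<le> g $ i" using assms(1) by (auto simp: nonneg_vecs_def)
  have "(g $ i + \<beta> * (1 - g $ i)) * ln (g $ i + \<beta> * (1 - g $ i)) * w $ i
      \<le> (1 - \<beta>) * (g $ i * ln (g $ i)) * w $ i" if "i < N" for i
    using xlnx_segment_to_one_le[of "g $ i" \<beta>] assms g that by (intro mult_right_mono) auto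
  then have "(\<Sum>i<N. (g $ i + \<beta> * (1 - g $ i)) * ln (g $ i + \<beta> * (1 - g $ i)) * w $ i)
      \<le> (\<Sum>i<N. (1 - \<beta>) * (g $ i * ln (g $ i)) * w $ i)"
    by (intro sum_mono) auto
  also have "\<dots> = (1 - \<beta>) * entropy w g"
    by (simp add: entropy_def g sum_distrib_left mult.assoc)
  finally show ?thesis
    by (simp add: entropy_def ones_def g)
qed

text \<open>As \<open>g\<close> has the mass of \<open>ones N\<close>, the linear terms of \<Phi>
  sum to zero, and the quadratic lower bound on \<Phi> becomes one on the entropy.\<close>

lemma entropy_ge_wnorm_2_sq:
  assumes g: "g \<in> nonneg_vecs N" and w: "w \<in> carrier_vec N" "\<forall>i<N. 0 \<le> w $ i"
    and mass: "wnorm w 1 g = volume w"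
  shows "(wnorm w 2 (ones N - g))\<^sup>2 \<le> 2 * (maxnorm g + 1) * entropy w g"
proof -
  have gN: "dim_vec g = N" "\<forall>i<N. 0 \<le> g $ i" using g by (auto simp: nonneg_vecs_def)
  let ?\<Phi> = "\<lambda>i. g $ i * ln (g $ i) - g $ i + 1"
  have "(g $ i - 1)\<^sup>2 * w $ i \<le> 2 * (maxnorm g + 1) * ?\<Phi> i * w $ i" if i: "i < N" for i
  proof (rule mult_right_mono)
    have "\<bar>g $ i\<bar> \<le> maxnorm g"
      unfolding maxnorm_def using i gN by (intro Max_ge) auto
    \<comment> \<open>The tangent at \<open>1\<close> has slope zero. Nonnegativity lets the factor
      \<open>g $ i + 1\<close> grow to \<open>maxnorm g + 1\<close>.\<close>
    moreover have "0 \<le> ?\<Phi> i"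
      using xlnx_tangent_le[of "g $ i" 1] gN i by simp
    ultimately have "2 * (g $ i + 1) * ?\<Phi> i \<le> 2 * (maxnorm g + 1) * ?\<Phi> i"
      by (intro mult_right_mono) auto
    then show "(g $ i - 1)\<^sup>2 \<le> 2 * (maxnorm g + 1) * ?\<Phi> i"
      using xlnx_ge_quadratic[of "g $ i"] gN i by simp
  qed (use w i in auto)
  then have "(\<Sum>i<N. (g $ i - 1)\<^sup>2 * w $ i) \<le> (\<Sum>i<N. 2 * (maxnorm g + 1) * ?\<Phi> i * w $ i)"
    by (intro sum_mono) auto
  also have "\<dots> = 2 * (maxnorm g + 1) * (\<Sum>i<N. ?\<Phi> i * w $ i)"
    by (simp add: sum_distrib_left mult.assoc)
  also have "(\<Sum>i<N. ?\<Phi> i * w $ i) = entropy w g - wnorm w 1 g + volume w"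
    using w by (simp add: entropy_def wnorm_1_nonneg_vecs[OF g w(2)] volume_def gN
        algebra_simps sum.distrib sum_subtractf)
  finally have "(\<Sum>i<N. (g $ i - 1)\<^sup>2 * w $ i) \<le> 2 * (maxnorm g + 1) * entropy w g"
    using mass by simp
  moreover have "(wnorm w 2 (ones N - g))\<^sup>2 = (\<Sum>i<N. (g $ i - 1)\<^sup>2 * w $ i)"
    using w gN by (subst wnorm_2_eq_L2_set)
      (auto simp: L2_set_def ones_def power_mult_distrib power2_commute mult.commute
        intro!: sum_nonneg sum.cong)
  ultimately show ?thesis by simp
qed

text \<open>Cauchy-Schwarz is applied twice to the summed scalar bound: against
  \<open>h - g\<close>, and against the constant \<open>\<epsilon>\<close>, which yields
  \<open>sqrt (volume w)\<close>.\<close>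

lemma entropy_diff_le:
  assumes g: "g \<in> nonneg_vecs N" and h: "h \<in> nonneg_vecs N"
    and w: "w \<in> carrier_vec N" "\<forall>i<N. 0 \<le> w $ i"
    and mass: "wnorm w 1 g = wnorm w 1 h"
    and \<epsilon>: "wnorm w 2 (h - g) = \<epsilon>" "0 < \<epsilon>" "\<epsilon> \<le> 1"
  shows "entropy w g - entropy w h
    \<le> 2 * wnorm w 2 (ones N - g) * ((1 + sqrt (volume w)) * \<epsilon> * (1 + \<bar>ln \<epsilon>\<bar>))"
proof -
  have gN: "dim_vec g = N" "\<forall>i<N. 0 \<le> g $ i" using g by (auto simp: nonneg_vecs_def)
  have hN: "dim_vec h = N" "\<forall>i<N. 0 \<le> h $ i" using h by (auto simp: nonneg_vecs_def)
  define D where "D = wnorm w 2 (ones N - g)"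
  define G where "G = (\<lambda>i. sqrt (w $ i) * (ones N - g) $ i)"
  define H where "H = (\<lambda>i. sqrt (w $ i) * (h - g) $ i)"
  have D: "L2_set G {..<N} = D"
    using w gN by (simp add: D_def G_def wnorm_2_eq_L2_set)
  have H: "L2_set H {..<N} = \<epsilon>"
    using w gN hN \<epsilon>(1) by (simp add: H_def wnorm_2_eq_L2_set)
  have W: "L2_set (\<lambda>i. sqrt (w $ i)) {..<N} = sqrt (volume w)"
    using L2_set_sqrt_weights w by blast
  have L: "0 \<le> 2 * (1 + \<bar>ln \<epsilon>\<bar>)" by simp
  \<comment> \<open>The subtracted linear terms cancel because the masses agree.\<close>
  have "entropy w g - entropy w h
      = (\<Sum>i<N. ((g $ i * ln (g $ i) - g $ i) - (h $ i * ln (h $ i) - h $ i)) * w $ i)"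
    using mass wnorm_1_nonneg_vecs[OF g w(2)] wnorm_1_nonneg_vecs[OF h w(2)]
    by (simp add: entropy_def gN hN left_diff_distrib sum_subtractf)
  also have "\<dots> \<le> (\<Sum>i<N. 2 * \<bar>g $ i - 1\<bar> *
      ((\<bar>g $ i - h $ i\<bar> + \<epsilon>) * (1 + \<bar>ln \<epsilon>\<bar>)) * w $ i)"
    using xlnx_diff_le \<epsilon> gN hN w by (intro sum_mono mult_right_mono) auto
  \<comment> \<open>Each weight splits into two square roots, one for each factor of a
    Cauchy-Schwarz product.\<close>
  also have "\<dots> = (\<Sum>i<N. 2 * (1 + \<bar>ln \<epsilon>\<bar>) *
      (\<bar>G i\<bar> * \<bar>H i\<bar> + \<epsilon> * (\<bar>G i\<bar> * \<bar>sqrt (w $ i)\<bar>)))"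
  proof (rule sum.cong)
    fix i assume "i \<in> {..<N}"
    then have i: "i < N" by simp
    then have sq: "sqrt (w $ i) * sqrt (w $ i) = w $ i" using w by simp
    have "\<bar>G i\<bar> = sqrt (w $ i) * \<bar>g $ i - 1\<bar>" "\<bar>H i\<bar> = sqrt (w $ i) * \<bar>g $ i - h $ i\<bar>"
      using i w gN hN by (auto simp: G_def H_def ones_def abs_mult abs_minus_commute)
    moreover have "\<bar>sqrt (w $ i)\<bar> = sqrt (w $ i)" using i w by simp
    ultimately have
      "\<bar>G i\<bar> * \<bar>H i\<bar> = (sqrt (w $ i) * sqrt (w $ i)) * (\<bar>g $ i - 1\<bar> * \<bar>g $ i - h $ i\<bar>)"
      "\<bar>G i\<bar> * \<bar>sqrt (w $ i)\<bar> = (sqrt (w $ i) * sqrt (w $ i)) * \<bar>g $ i - 1\<bar>"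
      by (simp_all only: ac_simps)
    then show "2 * \<bar>g $ i - 1\<bar> * ((\<bar>g $ i - h $ i\<bar> + \<epsilon>) * (1 + \<bar>ln \<epsilon>\<bar>)) * w $ i
        = 2 * (1 + \<bar>ln \<epsilon>\<bar>) * (\<bar>G i\<bar> * \<bar>H i\<bar> + \<epsilon> * (\<bar>G i\<bar> * \<bar>sqrt (w $ i)\<bar>))"
      unfolding sq by (simp add: algebra_simps)
  qed simp
  also have "\<dots> = 2 * (1 + \<bar>ln \<epsilon>\<bar>) * ((\<Sum>i<N. \<bar>G i\<bar> * \<bar>H i\<bar>) +
      \<epsilon> * (\<Sum>i<N. \<bar>G i\<bar> * \<bar>sqrt (w $ i)\<bar>))"
    by (simp only: sum.distrib sum_distrib_left[symmetric])
  also have "\<dots> \<le> 2 * (1 + \<bar>ln \<epsilon>\<bar>) * (D * \<epsilon> + \<epsilon> * (D * sqrt (volume w)))"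
    using L2_set_mult_ineq[of G H "{..<N}"] L2_set_mult_ineq[of G "\<lambda>i. sqrt (w $ i)" "{..<N}"] \<epsilon>
    by (intro mult_left_mono[OF _ L] add_mono) (auto simp: D H W)
  also have "\<dots> = 2 * D * ((1 + sqrt (volume w)) * \<epsilon> * (1 + \<bar>ln \<epsilon>\<bar>))"
    by (simp add: algebra_simps)
  finally show ?thesis by (simp add: D_def)
qed

section \<open>The estimate for the entropy fix\<close>

text \<open>The static form of the result: \<open>h\<close> stands for the exact solution at the
  final time, and entropy decay survives as \<open>dec\<close>.\<close>

lemma wnorm_2_entropy_fix_le:
  assumes g: "g \<in> nonneg_vecs N" and h: "h \<in> nonneg_vecs N"
    and N: "N \<ge> 1" and w: "w \<in> carrier_vec N" "\<forall>i<N. 0 < w $ i"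
    and mass: "wnorm w 1 g = wnorm w 1 h" "wnorm w 1 h = volume w"
    and dec: "entropy w h < entropy w g"
    and \<beta>: "0 < \<beta>" "\<beta> \<le> 1" "entropy w (g + \<beta> \<cdot>\<^sub>v (ones N - g)) = entropy w h"
    and le1: "wnorm w 2 (h - g) \<le> 1"
  shows "wnorm w 2 (\<beta> \<cdot>\<^sub>v (ones N - g)) \<le> 4 * (maxnorm g + 1) * (1 + sqrt (volume w)) *
    wnorm w 2 (h - g) * (1 + \<bar>ln (wnorm w 2 (h - g))\<bar>)"
proof -
  have gN: "dim_vec g = N" using g by (auto simp: nonneg_vecs_def)
  have hN: "dim_vec h = N" using h by (auto simp: nonneg_vecs_def)
  have w0: "\<forall>i<N. 0 \<le> w $ i" using w by (auto intro: less_imp_le)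
  define \<epsilon> where "\<epsilon> = wnorm w 2 (h - g)"
  define D where "D = wnorm w 2 (ones N - g)"
  define R where "R = (1 + sqrt (volume w)) * \<epsilon> * (1 + \<bar>ln \<epsilon>\<bar>)"
  \<comment> \<open>A zero error would force \<open>h = g\<close>, against the strict inequality
    \<open>dec\<close>.\<close>
  have "\<epsilon> \<noteq> 0"
  proof
    assume "\<epsilon> = 0"
    then have "\<forall>i<N. w $ i = 0 \<or> h $ i = g $ i"
      using w0 gN hN by (auto simp: \<epsilon>_def wnorm_2_eq_L2_set L2_set_eq_0_iff)
    then have "\<forall>i<N. h $ i = g $ i" using w by force
    then have "h = g" using gN hN by (intro eq_vecI) auto
    then show False using dec by simp
  qed
  then have \<epsilon>: "0 < \<epsilon>" "\<epsilon> \<le> 1" using le1 by (auto simp: \<epsilon>_def wnorm_def order_less_le)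
  have V: "0 \<le> volume w" using w0 w by (auto simp: volume_def intro: sum_nonneg)
  have "0 \<le> \<bar>g $ 0\<bar>" by simp
  also have "\<bar>g $ 0\<bar> \<le> maxnorm g"
    unfolding maxnorm_def using N gN by (intro Max_ge) auto
  finally have A: "0 \<le> maxnorm g" .
  have D0: "0 \<le> D" by (simp add: D_def wnorm_def)
  have R0: "0 \<le> R" unfolding R_def using \<epsilon> V by (intro mult_nonneg_nonneg add_nonneg_nonneg) auto
  \<comment> \<open>Chaining the lower bound, convexity and the upper bound puts a factor
    \<open>D\<close> on both sides.\<close>
  have "\<beta> * D\<^sup>2 \<le> \<beta> * (2 * (maxnorm g + 1) * entropy w g)"
    using entropy_ge_wnorm_2_sq[OF g w(1) w0] mass \<beta> unfolding D_def
    by (intro mult_left_mono) auto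
  also have "\<dots> = 2 * (maxnorm g + 1) * (\<beta> * entropy w g)" by simp
  also have "\<dots> \<le> 2 * (maxnorm g + 1) * (2 * D * R)"
  proof (rule mult_left_mono)
    have "\<beta> * entropy w g \<le> entropy w g - entropy w h"
      using entropy_segment_to_ones_le[OF g w0 \<beta>(1,2)] \<beta>(3) by (simp add: algebra_simps)
    also have "\<dots> \<le> 2 * D * R"
      using entropy_diff_le[OF g h w(1) w0 mass(1) \<epsilon>_def[symmetric] \<epsilon>] by (simp add: D_def R_def)
    finally show "\<beta> * entropy w g \<le> 2 * D * R" .
  qed (use A in simp)
  finally have "D * (\<beta> * D) \<le> D * (4 * (maxnorm g + 1) * R)"
    by (simp add: power2_eq_square algebra_simps)
  \<comment> \<open>For \<open>D = 0\<close> cancellation fails, but then the left side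
    vanishes.\<close>
  then have "\<beta> * D \<le> 4 * (maxnorm g + 1) * R"
    using D0 A R0 by (cases "D = 0") auto
  moreover have "wnorm w 2 (\<beta> \<cdot>\<^sub>v (ones N - g)) = \<beta> * D"
  proof -
    have "wnorm w 2 (\<beta> \<cdot>\<^sub>v (ones N - g))
        = L2_set (\<lambda>i. \<beta> * (sqrt (w $ i) * (ones N - g) $ i)) {..<N}"
      using w0 gN by (auto simp: wnorm_2_eq_L2_set intro!: L2_set_cong)
    also have "\<dots> = \<beta> * D"
      using \<beta> w0 gN by (simp add: L2_set_right_distrib[symmetric] D_def wnorm_2_eq_L2_set)
    finally show ?thesis .
  qed
  ultimately show ?thesis by (simp add: R_def \<epsilon>_def mult.assoc)
qed

theorem theorem2p2:
  "\<exists>M :: real \<Rightarrow> real \<Rightarrow> real \<Rightarrow> real.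
     (\<forall>V a b. M V a b > 0) \<and>
     (\<forall>(N::nat) (w :: real vec) (Q :: nat \<Rightarrow> real vec \<Rightarrow> real)
        (t0::real) (t1::real) (f :: real \<Rightarrow> real vec) (f0 :: real vec) (g :: real vec) (\<beta>::real).
        N \<ge> 1 \<longrightarrow>
        w \<in> carrier_vec N \<longrightarrow> (\<forall>i<N. w $ i > 0) \<longrightarrow>
        structure_preserving N w Q \<longrightarrow>
        f0 \<in> nonneg_vecs N \<longrightarrow> wnorm w 1 f0 = volume w \<longrightarrow>
        t0 < t1 \<longrightarrow> ode_solution N Q t0 t1 f \<longrightarrow> f t0 = f0 \<longrightarrow>
        g \<in> nonneg_vecs N \<longrightarrow> wnorm w 1 g = wnorm w 1 (f t1) \<longrightarrow> wnorm w 1 (f t1) = volume w \<longrightarrow>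
        entropy w g > entropy w f0 \<longrightarrow>
        0 < \<beta> \<longrightarrow> \<beta> \<le> 1 \<longrightarrow>
        entropy w (g + \<beta> \<cdot>\<^sub>v (ones N - g)) = entropy w (f t1) \<longrightarrow>
        wnorm w 2 (f t1 - g) \<le> 1 \<longrightarrow>
        wnorm w 2 (\<beta> \<cdot>\<^sub>v (ones N - g))
          \<le> M (volume w) (maxnorm g) (maxnorm (f t1)) *
             wnorm w 2 (f t1 - g) * (1 + \<bar>ln (wnorm w 2 (f t1 - g))\<bar>))"
\<comment> \<open>The absolute values make the witness positive at all real arguments, not just at
  volumes and norms.\<close>
proof (intro exI[where x = "\<lambda>V a b. 4 * (\<bar>a\<bar> + 1) * (1 + sqrt \<bar>V\<bar>)"] conjI allI impI)
  fix V a :: real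
  show "0 < 4 * (\<bar>a\<bar> + 1) * (1 + sqrt \<bar>V\<bar>)"
    by (intro mult_pos_pos add_nonneg_pos add_pos_nonneg) auto
next
  fix N w Q t0 t1 f f0 g \<beta>
  assume N: "N \<ge> (1::nat)" and w: "w \<in> carrier_vec N" "\<forall>i<N. w $ i > (0::real)"
    and Q: "structure_preserving N w Q" and f0: "f0 \<in> nonneg_vecs N"
    and t: "t0 < t1" and f: "ode_solution N Q t0 t1 f" "f t0 = f0"
    and g: "g \<in> nonneg_vecs N"
    and mass: "wnorm w 1 g = wnorm w 1 (f t1)" "wnorm w 1 (f t1) = volume w"
    and inc: "entropy w g > entropy w f0"
    and \<beta>: "0 < \<beta>" "\<beta> \<le> 1" "entropy w (g + \<beta> \<cdot>\<^sub>v (ones N - g)) = entropy w (f t1)"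
    and le1: "wnorm w 2 (f t1 - g) \<le> 1"
  have h: "f t1 \<in> nonneg_vecs N" and "antimono_on {t0..t1} (\<lambda>t. entropy w (f t))"
    using Q t f f0 unfolding structure_preserving_def by auto
  \<comment> \<open>Decay between the end points puts the exact entropy below that of
    \<open>f0\<close>, hence strictly below that of \<open>g\<close>.\<close>
  then have "entropy w (f t1) \<le> entropy w f0"
    using t f(2) monotone_onD[of "{t0..t1}" "(\<le>)" "(\<ge>)" "\<lambda>t. entropy w (f t)" t0 t1] by auto
  then have dec: "entropy w (f t1) < entropy w g" using inc by simp
  have V: "0 \<le> volume w" using w by (auto simp: volume_def less_imp_le intro!: sum_nonneg)
  let ?c = "(1 + sqrt (volume w)) * wnorm w 2 (f t1 - g) * (1 + \<bar>ln (wnorm w 2 (f t1 - g))\<bar>)"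
  have "0 \<le> ?c" using V by (simp add: wnorm_def)
  then have "4 * (maxnorm g + 1) * ?c \<le> 4 * (\<bar>maxnorm g\<bar> + 1) * ?c"
    by (intro mult_right_mono) auto
  then show "wnorm w 2 (\<beta> \<cdot>\<^sub>v (ones N - g)) \<le> 4 * (\<bar>maxnorm g\<bar> + 1) * (1 + sqrt \<bar>volume w\<bar>) *
      wnorm w 2 (f t1 - g) * (1 + \<bar>ln (wnorm w 2 (f t1 - g))\<bar>)"
    using wnorm_2_entropy_fix_le[OF g h N w mass dec \<beta> le1] V by (simp add: mult.assoc)
qed

end
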